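(* Let $m,n\in\{1,2,3,\dots\}\cup\{\infty\}$ with at least one of $m,n$ finite. Then the conjugacy relation on the automorphism group of the graph $m\cdot K_n$ is smooth.
   Context: $K_n$ is the complete graph on $n$ vertices ($K_\infty$ the countably infinite complete graph), and $m\cdot K_n$ is the undirected graph consisting of $m$ disjoint copies of $K_n$ with no edges between distinct copies. The automorphism group is viewed as a Polish group (subgroup of the symmetric group of the countable vertex set), and the conjugacy relation identifies $\phi,\psi$ iff $\psi=\delta\phi\delta^{-1}$ for some automorphism $\delta$. An equivalence relation $E$ on a standard Borel space $X$ is smooth if there is a Borel $f\colon X\to Y$ into a standard Borel space with $x\mathrel{E}x'\iff f(x)=f(x')$. *)

theory Defs
  imports "HOL-Analysis.Analysis" "HOL-Combinatorics.Permutations" "HOL-Library.Extended_Nat"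
begin

section \<open>Graphs and their automorphisms\<close>

text \<open>An undirected graph is given by its vertex set and its set of edges, the edges being
  two-element sets of vertices.\<close>

type_synonym 'v ugraph = "'v set \<times> 'v set set"

abbreviation vertices :: "'v ugraph \<Rightarrow> 'v set" where
  "vertices G \<equiv> fst G"

abbreviation edges :: "'v ugraph \<Rightarrow> 'v set set" where
  "edges G \<equiv> snd G"

text \<open>The case \<open>n = \<infinity>\<close> gives the complete graph on all natural numbers.\<close>

definition complete_graph :: "enat \<Rightarrow> nat ugraph" where
  "complete_graph n =
     ({j. enat j < n}, {{j, k} | j k. enat j < n \<and> enat k < n \<and> j \<noteq> k})"

definition disjoint_copies :: "enat \<Rightarrow> 'v ugraph \<Rightarrow> (nat \<times> 'v) ugraph" where
  "disjoint_copies m G =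
     ({i. enat i < m} \<times> vertices G, {Pair i ` e | i e. enat i < m \<and> e \<in> edges G})"

text \<open>Permutations of the vertex set are functions on the whole type that fix every
  element outside the vertex set, so that each automorphism has exactly one representative.\<close>

definition automorphisms :: "'v ugraph \<Rightarrow> ('v \<Rightarrow> 'v) set" where
  "automorphisms G =
     {\<phi>. \<phi> permutes vertices G \<and>
         (\<forall>u\<in>vertices G. \<forall>v\<in>vertices G. {\<phi> u, \<phi> v} \<in> edges G \<longleftrightarrow> {u, v} \<in> edges G)}"

definition conjugacy_rel :: "'v ugraph \<Rightarrow> (('v \<Rightarrow> 'v) \<times> ('v \<Rightarrow> 'v)) set" where
  "conjugacy_rel G =
     {(\<phi>, \<psi>). \<phi> \<in> automorphisms G \<and> \<psi> \<in> automorphisms G \<and>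
        (\<exists>\<delta>\<in>automorphisms G. \<psi> = \<delta> \<circ> \<phi> \<circ> inv \<delta>)}"

text \<open>The topology that the automorphism group inherits from the symmetric group of the
  vertex set, i.e. pointwise convergence with discrete values. The coordinates outside the
  vertex set are constant on automorphisms and hence contribute nothing.\<close>

definition aut_topology :: "'v ugraph \<Rightarrow> ('v \<Rightarrow> 'v) topology" where
  "aut_topology G =
     subtopology (product_topology (\<lambda>_. discrete_topology UNIV) UNIV) (automorphisms G)"


section \<open>Smooth equivalence relations\<close>

definition borel_of :: "'a topology \<Rightarrow> 'a measure" where
  "borel_of T = sigma (topspace T) {U. openin T U}"

definition standard_borel :: "'a measure \<Rightarrow> bool" where
  "standard_borel M \<longleftrightarrow>
     (\<exists>T. completely_metrizable_space T \<and> separable_space T \<and> sets M = sets (borel_of T))"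

text \<open>The target space has to live in a fixed type. This is no restriction: a standard Borel
  space has at most the cardinality of the continuum, so it is isomorphic to a standard Borel
  space whose carrier is a subset of \<open>nat \<Rightarrow> nat\<close>.\<close>

definition smooth_equiv :: "'a measure \<Rightarrow> ('a \<times> 'a) set \<Rightarrow> bool" where
  "smooth_equiv X E \<longleftrightarrow>
     standard_borel X \<and> equiv (space X) E \<and>
     (\<exists>(Y :: (nat \<Rightarrow> nat) measure) f. standard_borel Y \<and> f \<in> X \<rightarrow>\<^sub>M Y \<and>
        (\<forall>x\<in>space X. \<forall>x'\<in>space X. (x, x') \<in> E \<longleftrightarrow> f x = f x'))"

end

(*
  An automorphism f of m copies of K_n permutes the copies; call this permutation base f. A cycle of
  base f, together with the action of f on the copies that it visits, is determined up to isomorphism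
  by its length k and by the number of f-cycles of each length s inside it: choose one point of every
  such f-cycle in one fixed copy and translate along f. Hence f is determined up to conjugacy by the
  number of cycles of base f with each type (k, numbers of f-cycles). There may be uncountably many
  types, but for fixed k only finitely many are realised: if m is finite because there are only
  finitely many copies, and if n is finite because s is at most k * n and each number at most n (for
  k = 0, an infinite cycle, s is 0). So finitely many coordinates separate the types, and
  it suffices to count the cycles whose type has a prescribed finite part. These are countably many
  conjugacy invariants, and each of them is Borel.
*)
theory Submission
  imports Defs
begin

section \<open>The Polish space of automorphisms\<close>

text \<open>Links the discrete coordinates of \<open>aut_topology\<close> with the type class
  topology, so that results on \<open>euclidean\<close> function spaces apply.\<close>

lemma euclidean_nat_pair: "(euclidean :: (nat \<times> nat) topology) = discrete_topology UNIV"
proof -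
  have "open {p}" for p :: "nat \<times> nat"
    using open_Times[OF open_discrete[of "{fst p}"] open_discrete[of "{snd p}"]] by simp
  then show ?thesis using discrete_topology_unique[of UNIV "euclidean :: (nat \<times> nat) topology"] by auto
qed

lemma euclidean_nat: "(euclidean :: nat topology) = discrete_topology UNIV"
  using discrete_topology_unique[of UNIV "euclidean :: nat topology"] by (auto simp: open_discrete)

section \<open>Borel sets and standard Borel function spaces\<close>

lemma sets_borel_of: "sets (borel_of T) = sigma_sets (topspace T) {U. openin T U}"
  unfolding borel_of_def by (rule sets_measure_of) (auto dest: openin_subset)

lemma space_borel_of: "space (borel_of T) = topspace T"
  unfolding borel_of_def by (rule space_measure_of) (auto dest: openin_subset)

lemma second_countable_euclidean:
  "second_countable (euclidean :: 'a::second_countable_topology topology)"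
proof -
  obtain B :: "'a set set" where "countable B" "topological_basis B"
    using ex_countable_basis by blast
  then show ?thesis
    unfolding second_countable_def by (metis open_openin topological_basis_def topological_basisE)
qed

lemma completely_metrizable_euclidean_fun:
  assumes "(euclidean :: 'a::topological_space topology) = discrete_topology UNIV"
  shows "completely_metrizable_space (euclidean :: ('i::countable \<Rightarrow> 'a) topology)"
  unfolding euclidean_product_topology[symmetric] completely_metrizable_space_product_topology
  by (auto simp: assms completely_metrizable_space_discrete_topology)

text \<open>Complete metrizability passes to G-delta subspaces. Separability does not pass to
  subspaces in general, so it is obtained through second countability, which does.\<close>

lemma standard_borel_gdelta:
  fixes S :: "('i::countable \<Rightarrow> 'a::second_countable_topology) set"
  assumes "(euclidean :: 'a topology) = discrete_topology UNIV" "gdelta_in euclidean S"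
  shows "standard_borel (borel_of (subtopology euclidean S))"
  unfolding standard_borel_def
  using completely_metrizable_space_gdelta_in[OF completely_metrizable_euclidean_fun[OF assms(1)] assms(2)]
    second_countable_imp_separable_space[OF second_countable_subtopology[OF second_countable_euclidean]]
  by blast

lemma sets_borel_of_euclidean: "sets (borel_of euclidean) = sets borel"
  by (simp add: sets_borel_of borel_def)

lemma standard_borel_borel_nat_fun: "standard_borel (borel :: (nat \<Rightarrow> nat) measure)"
  using standard_borel_gdelta[of "UNIV :: (nat \<Rightarrow> nat) set"] euclidean_nat
  by (simp add: standard_borel_def sets_borel_of_euclidean gdelta_in_topspace[of euclidean, simplified])

section \<open>The automorphism group as a G-delta set\<close>

lemma gdelta_in_countable_Collect:
  fixes P :: "'a \<Rightarrow> 'i::countable \<Rightarrow> bool"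
  assumes "\<And>i. gdelta_in T {x \<in> topspace T. P x i}"
  shows "gdelta_in T {x \<in> topspace T. \<forall>i. P x i}"
proof -
  have "gdelta_in T (\<Inter>i. {x \<in> topspace T. P x i})"
    by (rule gdelta_in_Inter) (auto simp: assms)
  moreover have "(\<Inter>i. {x \<in> topspace T. P x i}) = {x \<in> topspace T. \<forall>i. P x i}" by auto
  ultimately show ?thesis by simp
qed

text \<open>Surjectivity is only a countable intersection of open conditions, so the automorphism group
  is a \<open>G\<^sub>\<delta>\<close> set but in general not closed in the space of all functions.\<close>

lemma gdelta_in_automorphisms:
  fixes G :: "'v::{countable, topological_space} ugraph"
  assumes disc: "(euclidean :: 'v topology) = discrete_topology UNIV"
  shows "gdelta_in (euclidean :: ('v \<Rightarrow> 'v) topology) (automorphisms G)"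
proof -
  let ?T = "euclidean :: ('v \<Rightarrow> 'v) topology"
  have dopen: "open A" for A :: "'v set"
    using disc by (metis open_openin openin_discrete_topology subset_UNIV)
  \<comment> \<open>A condition on two coordinates is a union of cylinders, hence open, because the
    values are discrete.\<close>
  have op: "open {f :: 'v \<Rightarrow> 'v. Q (f x) (f y)}" for Q x y
  proof -
    have "{f :: 'v \<Rightarrow> 'v. Q (f x) (f y)}
        = (\<Union>a. \<Union>b \<in> {b. Q a b}. (\<lambda>f. f x) -` {a} \<inter> (\<lambda>f. f y) -` {b})"
      by auto
    moreover have "open \<dots>"
      by (intro open_UN ballI open_Int open_vimage dopen continuous_on_product_coordinates)
    ultimately show ?thesis by simp
  qed
  \<comment> \<open>The unique preimage in \<open>permutes\<close> is split into injectivity and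
    surjectivity; everything except surjectivity is then a condition on pairs of
    coordinates.\<close>
  have "automorphisms G = {f. \<forall>x y.
      (x \<notin> vertices G \<longrightarrow> f x = x) \<and> (f x = f y \<longrightarrow> x = y) \<and>
      (x \<in> vertices G \<longrightarrow> y \<in> vertices G \<longrightarrow> ({f x, f y} \<in> edges G \<longleftrightarrow> {x, y} \<in> edges G))}
    \<inter> {f. \<forall>y. \<exists>x. f x = y}"
    unfolding automorphisms_def permutes_def by (auto 4 3)
  moreover have "gdelta_in ?T {f \<in> topspace ?T. \<forall>x y.
      (x \<notin> vertices G \<longrightarrow> f x = x) \<and> (f x = f y \<longrightarrow> x = y) \<and>
      (x \<in> vertices G \<longrightarrow> y \<in> vertices G \<longrightarrow> ({f x, f y} \<in> edges G \<longleftrightarrow> {x, y} \<in> edges G))}"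
  proof (intro gdelta_in_countable_Collect open_imp_gdelta_in)
    show "openin ?T {f \<in> topspace ?T. (x \<notin> vertices G \<longrightarrow> f x = x) \<and> (f x = f y \<longrightarrow> x = y) \<and>
        (x \<in> vertices G \<longrightarrow> y \<in> vertices G \<longrightarrow> ({f x, f y} \<in> edges G \<longleftrightarrow> {x, y} \<in> edges G))}" for x y
      using op[of "\<lambda>a b. (x \<notin> vertices G \<longrightarrow> a = x) \<and> (a = b \<longrightarrow> x = y) \<and>
        (x \<in> vertices G \<longrightarrow> y \<in> vertices G \<longrightarrow> ({a, b} \<in> edges G \<longleftrightarrow> {x, y} \<in> edges G))" x y]
      by simp
  qed
  moreover have "gdelta_in ?T {f \<in> topspace ?T. \<forall>y. \<exists>x. f x = y}"
  proof (intro gdelta_in_countable_Collect open_imp_gdelta_in)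
    fix y :: 'v
    have "open (\<Union>x. {f :: 'v \<Rightarrow> 'v. f x = y})" using op[of "\<lambda>a b. a = y"] by blast
    then show "openin ?T {f \<in> topspace ?T. \<exists>x. f x = y}"
      by (simp add: Collect_ex_eq)
  qed
  ultimately show ?thesis using gdelta_in_Int by (metis (no_types, lifting) Collect_cong UNIV_I topspace_euclidean)
qed

lemma aut_topology_nat_pair:
  fixes G :: "(nat \<times> nat) ugraph"
  shows "aut_topology G = subtopology euclidean (automorphisms G)"
  unfolding aut_topology_def euclidean_nat_pair[symmetric] euclidean_product_topology ..

lemma standard_borel_aut_topology:
  fixes G :: "(nat \<times> nat) ugraph"
  shows "standard_borel (borel_of (aut_topology G))"
  unfolding aut_topology_nat_pair
  by (intro standard_borel_gdelta gdelta_in_automorphisms euclidean_nat_pair)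

lemma space_borel_of_aut_topology: "space (borel_of (aut_topology G)) = automorphisms G"
  by (simp add: space_borel_of aut_topology_def)

text \<open>Evaluations are continuous with countable discrete range. The invariants below are built
  from them by countable operations, so this is where the topology enters their
  measurability.\<close>

lemma measurable_aut_eval:
  fixes G :: "'v::countable ugraph"
  shows "(\<lambda>f. f x) \<in> borel_of (aut_topology G) \<rightarrow>\<^sub>M count_space UNIV"
proof (subst measurable_count_space_eq2_countable, safe)
  fix a :: 'v
  have "openin (product_topology (\<lambda>_. discrete_topology UNIV) UNIV) {f :: 'v \<Rightarrow> 'v. f x = a}"
    using openin_continuous_map_preimage[OF continuous_map_product_projection[of x UNIV "\<lambda>_. discrete_topology (UNIV :: 'v set)"], of "{a}"]
    by simp
  then have "openin (aut_topology G) ((\<lambda>f. f x) -` {a} \<inter> automorphisms G)"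
    unfolding aut_topology_def openin_subtopology by (auto simp: vimage_def)
  then show "(\<lambda>f. f x) -` {a} \<inter> space (borel_of (aut_topology G)) \<in> sets (borel_of (aut_topology G))"
    by (simp add: space_borel_of_aut_topology sets_borel_of sigma_sets.Basic)
qed auto

section \<open>Orbits and transversals\<close>

text \<open>Meeting forward orbits: for a permutation this is lying on the same cycle, expressed
  without negative powers.\<close>

definition orb :: "('a \<Rightarrow> 'a) \<Rightarrow> 'a \<Rightarrow> 'a \<Rightarrow> bool" where
  "orb f x y \<longleftrightarrow> (\<exists>a b. (f ^^ a) x = (f ^^ b) y)"

text \<open>The value 0 stands for an infinite orbit.\<close>
definition per :: "('a \<Rightarrow> 'a) \<Rightarrow> 'a \<Rightarrow> nat" where
  "per f x = Gcd {t. (f ^^ t) x = x}"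

text \<open>A list instead of a finite set, so that the existential quantifier ranges over a countable
  type.\<close>
definition at_least_classes :: "nat \<Rightarrow> 'a set \<Rightarrow> ('a \<Rightarrow> 'a \<Rightarrow> bool) \<Rightarrow> bool" where
  "at_least_classes j A r \<longleftrightarrow>
     (\<exists>xs. length xs = j \<and> set xs \<subseteq> A \<and> sorted_wrt (\<lambda>x y. \<not> r x y) xs)"

text \<open>The return times are closed under multiples and under remainders modulo the least
  positive one, so they are exactly its multiples, or only 0 if there is no positive one. In both
  cases the \<open>Gcd\<close> is the generator.\<close>

lemma funpow_fixed_iff_per_dvd:
  assumes "inj f"
  shows "(f ^^ t) x = x \<longleftrightarrow> per f x dvd t"
proof -
  let ?S = "{t. (f ^^ t) x = x}"
  have cancel: "(f ^^ t) x = x" if "(f ^^ (s + t)) x = x" "(f ^^ s) x = x" for s t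
    using that by (metis add.commute comp_apply funpow_add)
  have mult: "(f ^^ (s * k)) x = x" if "(f ^^ s) x = x" for s k
    using that by (induction k) (auto simp: funpow_add)
  show ?thesis
  proof (cases "\<exists>s>0. (f ^^ s) x = x")
    case True
    define d where "d = (LEAST s. s > 0 \<and> (f ^^ s) x = x)"
    have d: "d > 0" "(f ^^ d) x = x" using LeastI_ex[OF True] by (auto simp: d_def)
    have S: "s \<in> ?S \<longleftrightarrow> d dvd s" for s
    proof
      assume "s \<in> ?S"
      then have "(f ^^ (s mod d)) x = x"
        using cancel[of "d * (s div d)" "s mod d"] mult[OF d(2), of "s div d"] by simp
      then have "s mod d = 0"
        using not_less_Least[of "s mod d" "\<lambda>s. s > 0 \<and> (f ^^ s) x = x"] mod_less_divisor[OF d(1), of s]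
        by (auto simp: d_def)
      then show "d dvd s" by auto
    next
      assume "d dvd s"
      then show "s \<in> ?S" using mult[OF d(2)] by (auto elim!: dvdE)
    qed
    have "per f x = d"
      unfolding per_def
      by (intro dvd_antisym Gcd_dvd Gcd_greatest) (use S in auto)
    then show ?thesis using S by simp
  next
    case False
    then have "?S = {0}" by (auto intro: ccontr)
    then show ?thesis using False by (auto simp: per_def)
  qed
qed

text \<open>Trades the \<open>Gcd\<close> for a countable conjunction of equations, the form in
  which the period is seen to be Borel.\<close>

lemma per_eq_iff:
  assumes "inj f"
  shows "per f x = s \<longleftrightarrow> (\<forall>t. (f ^^ t) x = x \<longleftrightarrow> s dvd t)"
  unfolding funpow_fixed_iff_per_dvd[OF assms] by (metis dvd_antisym dvd_refl)

lemma inj_funpow_iff: "inj (f :: 'a \<Rightarrow> 'a) \<Longrightarrow> (f ^^ k) x = (f ^^ k) y \<longleftrightarrow> x = y"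
  using inj_fn[of f k] by (auto simp: inj_eq)

text \<open>Cancelling the smaller power leaves a return time. As \<open>p mod 0 = p\<close>, the
  value 0 for an infinite orbit fits in: all powers are then different.\<close>

lemma funpow_eq_funpow_iff:
  assumes "inj f"
  shows "(f ^^ p) x = (f ^^ q) x \<longleftrightarrow> p mod per f x = q mod per f x"
proof (induction p q rule: linorder_wlog)
  case (le p q)
  then have "(f ^^ q) x = (f ^^ (p + (q - p))) x" by simp
  also have "\<dots> = (f ^^ p) ((f ^^ (q - p)) x)" by (simp only: funpow_add comp_apply)
  finally have "(f ^^ p) x = (f ^^ q) x \<longleftrightarrow> x = (f ^^ (q - p)) x"
    using inj_funpow_iff[OF assms] by simp
  also have "\<dots> \<longleftrightarrow> per f x dvd q - p"
    using funpow_fixed_iff_per_dvd[OF assms, of "q - p" x] by auto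
  also have "\<dots> \<longleftrightarrow> q mod per f x = p mod per f x"
    using le by (simp add: mod_eq_dvd_iff_nat)
  finally show ?case by auto
qed auto

lemma equivp_orb: "equivp (orb f)"
proof (rule equivpI)
  show "reflp (orb f)" by (auto simp: reflp_def orb_def)
  show "symp (orb f)" unfolding symp_def orb_def by metis
  show "transp (orb f)"
  proof (rule transpI)
    fix x y z assume "orb f x y" "orb f y z"
    then obtain a b c d where 1: "(f ^^ a) x = (f ^^ b) y" "(f ^^ c) y = (f ^^ d) z"
      by (auto simp: orb_def)
    have "(f ^^ (c + a)) x = (f ^^ c) ((f ^^ b) y)" by (simp add: funpow_add 1)
    also have "\<dots> = (f ^^ (b + c)) y" by (metis add.commute comp_apply funpow_add)
    also have "\<dots> = (f ^^ (b + d)) z" by (simp add: funpow_add 1)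
    finally show "orb f x z" unfolding orb_def by blast
  qed
qed

section \<open>Transport along semiconjugacies\<close>

lemma funpow_semiconj:
  assumes "\<And>x. d (f x) = g (d x)"
  shows "(g ^^ t) (d x) = d ((f ^^ t) x)"
  by (induction t) (auto simp: assms)

lemma per_semiconj:
  assumes "inj d" "\<And>x. d (f x) = g (d x)"
  shows "per g (d x) = per f x"
  unfolding per_def using assms by (simp add: funpow_semiconj[of d f g] inj_eq)

lemma orb_semiconj:
  assumes "inj d" "\<And>x. d (f x) = g (d x)"
  shows "orb g (d x) (d y) \<longleftrightarrow> orb f x y"
  unfolding orb_def using assms by (simp add: funpow_semiconj[of d f g] inj_eq)

lemma orb_invariant:
  assumes "\<And>x. L (f x) = L x" "orb f x y"
  shows "L x = L y"
proof -
  have "L ((f ^^ t) x) = L x" for t x by (induction t) (auto simp: assms)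
  then show ?thesis using assms(2) unfolding orb_def by metis
qed

lemma per_orb: "inj f \<Longrightarrow> orb f x y \<Longrightarrow> per f x = per f y"
  using orb_invariant[of "per f" f] per_semiconj[of f f f] by blast

lemma at_least_classes_image:
  assumes "\<And>x y. x \<in> A \<Longrightarrow> y \<in> A \<Longrightarrow> r' (d x) (d y) \<longleftrightarrow> r x y"
  shows "at_least_classes j (d ` A) r' \<longleftrightarrow> at_least_classes j A r"
proof
  assume "at_least_classes j (d ` A) r'"
  then obtain xs where xs: "length xs = j" "xs \<in> lists (d ` A)" "sorted_wrt (\<lambda>x y. \<not> r' x y) xs"
    by (auto simp: at_least_classes_def)
  then obtain ys where "xs = map d ys" "set ys \<subseteq> A" unfolding lists_image by auto
  then show "at_least_classes j A r"
    unfolding at_least_classes_def using xs assms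
    by (intro exI[of _ ys]) (auto simp: sorted_wrt_map subset_iff intro: sorted_wrt_mono_rel[rotated])
next
  assume "at_least_classes j A r"
  then obtain xs where "length xs = j" "set xs \<subseteq> A" "sorted_wrt (\<lambda>x y. \<not> r x y) xs"
    by (auto simp: at_least_classes_def)
  then show "at_least_classes j (d ` A) r'"
    unfolding at_least_classes_def using assms
    by (intro exI[of _ "map d xs"]) (auto simp: sorted_wrt_map subset_iff intro: sorted_wrt_mono_rel[rotated])
qed

section \<open>Representatives and the number of classes\<close>

definition transversal :: "('a \<Rightarrow> 'a \<Rightarrow> bool) \<Rightarrow> 'a set \<Rightarrow> 'a set \<Rightarrow> bool" where
  "transversal r A R \<longleftrightarrow>
     R \<subseteq> A \<and> (\<forall>a\<in>A. \<exists>x\<in>R. r a x) \<and> (\<forall>x\<in>R. \<forall>y\<in>R. r x y \<longrightarrow> x = y)"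

lemma transversal_subset: "transversal r A R \<Longrightarrow> R \<subseteq> A"
  and transversal_ex: "transversal r A R \<Longrightarrow> a \<in> A \<Longrightarrow> \<exists>x\<in>R. r a x"
  and transversal_unique: "transversal r A R \<Longrightarrow> x \<in> R \<Longrightarrow> y \<in> R \<Longrightarrow> r x y \<Longrightarrow> x = y"
  unfolding transversal_def by blast+

text \<open>Replacing list entries by their representatives keeps inequivalent entries apart.
  Counting classes thus becomes counting elements of a set, from which bijections can be
  built.\<close>

lemma at_least_classes_transversal:
  assumes r: "equivp r" and R: "transversal r A R"
  shows "at_least_classes j A r \<longleftrightarrow> (\<exists>F. F \<subseteq> R \<and> finite F \<and> card F = j)"
proof
  assume "at_least_classes j A r"
  then obtain xs where xs: "length xs = j" "set xs \<subseteq> A" "sorted_wrt (\<lambda>x y. \<not> r x y) xs"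
    by (auto simp: at_least_classes_def)
  obtain h where h: "\<And>a. a \<in> A \<Longrightarrow> h a \<in> R \<and> r a (h a)" using R unfolding transversal_def by metis
  have "distinct (map h xs)"
    using xs(2,3)
  proof (induction xs)
    case (Cons a xs)
    have "h a \<noteq> h b" if "b \<in> set xs" for b
    proof
      assume "h a = h b"
      moreover have "r a (h a)" "r b (h b)" using Cons.prems that h by auto
      ultimately have "r a b" using r by (metis equivp_symp equivp_transp)
      then show False using Cons.prems that by auto
    qed
    moreover have "distinct (map h xs)" using Cons by simp
    ultimately show ?case by auto
  qed simp
  then show "\<exists>F. F \<subseteq> R \<and> finite F \<and> card F = j"
    using xs h distinct_card[of "map h xs"] by (intro exI[of _ "set (map h xs)"]) auto
next
  assume "\<exists>F. F \<subseteq> R \<and> finite F \<and> card F = j"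
  then obtain F where F: "F \<subseteq> R" "finite F" "card F = j" by auto
  then obtain xs where xs: "set xs = F" "distinct xs" using finite_distinct_list by blast
  have "sorted_wrt (\<lambda>x y. \<not> r x y) xs"
    unfolding sorted_wrt_iff_nth_less
  proof (intro allI impI)
    fix p q assume pq: "p < q" "q < length xs"
    then have "xs ! p \<in> R" "xs ! q \<in> R" "xs ! p \<noteq> xs ! q"
      using xs F(1) nth_mem[of p xs] nth_mem[of q xs] by (auto simp: nth_eq_iff_index_eq)
    then show "\<not> r (xs ! p) (xs ! q)" using R unfolding transversal_def by blast
  qed
  then show "at_least_classes j A r"
    unfolding at_least_classes_def using xs F R distinct_card[of xs] by (intro exI[of _ xs]) (auto simp: transversal_def)
qed

lemma transversal_exists:
  assumes r: "equivp r"
  shows "\<exists>R. transversal r A R"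
proof -
  define h where "h a = (SOME x. x \<in> A \<and> r a x)" for a
  have h: "h a \<in> A \<and> r a (h a)" if "a \<in> A" for a
    unfolding h_def by (rule someI[of _ a]) (use that r in \<open>auto simp: equivp_def\<close>)
  \<comment> \<open>Equivalent points have the same predicate \<open>r a\<close>, so
    \<open>SOME\<close> makes the same choice for them.\<close>
  have eq: "h a = h b" if "r a b" for a b
  proof -
    have "r a = r b" using that r by (simp add: equivp_def)
    then show ?thesis by (simp add: h_def)
  qed
  have "x = y" if "x \<in> h ` A" "y \<in> h ` A" "r x y" for x y
  proof -
    from \<open>x \<in> h ` A\<close> \<open>y \<in> h ` A\<close> obtain a b where ab: "x = h a" "y = h b" "a \<in> A" "b \<in> A" by blast
    then have "r a x" "r b y" using h by auto
    then have "r a b" using \<open>r x y\<close> r by (metis equivp_symp equivp_transp)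
    then show "x = y" using ab eq by blast
  qed
  moreover have "h ` A \<subseteq> A" "\<forall>a\<in>A. \<exists>x\<in>h ` A. r a x" using h by auto
  ultimately show ?thesis unfolding transversal_def by blast
qed

text \<open>The sizes of finite subsets tell whether a set is infinite and, if not, its cardinality;
  countability leaves only one infinite cardinality.\<close>

lemma bij_betw_of_finite_subsets:
  fixes A :: "'a::countable set" and B :: "'b::countable set"
  assumes "\<And>j. (\<exists>F. F \<subseteq> A \<and> finite F \<and> card F = j) \<longleftrightarrow> (\<exists>F. F \<subseteq> B \<and> finite F \<and> card F = j)"
  shows "\<exists>h. bij_betw h A B"
proof (cases "finite A \<and> finite B")
  case True
  obtain F where "F \<subseteq> B" "card F = card A" using assms[of "card A"] True by blast
  moreover obtain F' where "F' \<subseteq> A" "card F' = card B" using assms[of "card B"] True by blast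
  ultimately have "card A = card B" using True card_mono[of B F] card_mono[of A F'] by simp
  then show ?thesis using True by (simp add: finite_same_card_bij)
next
  case False
  have "infinite B" if "infinite A"
  proof
    assume "finite B"
    moreover obtain F where "F \<subseteq> B" "card F = Suc (card B)"
      using assms[of "Suc (card B)"] infinite_arbitrarily_large[OF \<open>infinite A\<close>, of "Suc (card B)"] by blast
    ultimately show False using card_mono[of B F] by simp
  qed
  moreover have "infinite A" if "infinite B"
  proof
    assume "finite A"
    moreover obtain F where "F \<subseteq> A" "card F = Suc (card A)"
      using assms[of "Suc (card A)"] infinite_arbitrarily_large[OF \<open>infinite B\<close>, of "Suc (card A)"] by blast
    ultimately show False using card_mono[of A F] by simp
  qed
  ultimately have "bij_betw (to_nat_on A) A UNIV" "bij_betw (from_nat_into B) UNIV B"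
    using False by (auto intro!: to_nat_on_infinite bij_betw_from_nat_into)
  then show ?thesis using bij_betw_trans by blast
qed

lemma transversal_restrict:
  assumes R: "transversal r A R" and L: "\<And>x y. r x y \<Longrightarrow> L x = L y"
  shows "transversal r {x \<in> A. L x = l} {x \<in> R. L x = l}"
proof -
  have "\<exists>x\<in>{x \<in> R. L x = l}. r a x" if a: "a \<in> A" "L a = l" for a
  proof -
    obtain x where x: "x \<in> R" "r a x" using R a unfolding transversal_def by blast
    then show ?thesis using L[OF x(2)] a by auto
  qed
  then show ?thesis using R by (auto simp: transversal_def)
qed

text \<open>The classes are matched separately for each label. Applied twice below: to the cycles of
  the base maps with their types, and to the cycles meeting one block with their lengths.\<close>

lemma transversals_match:
  fixes A :: "'a::countable set" and B :: "'b::countable set"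
  assumes r: "equivp r" "\<And>x y. r x y \<Longrightarrow> L x = L y" and r': "equivp r'" "\<And>x y. r' x y \<Longrightarrow> L' x = L' y"
    and count: "\<And>j l. at_least_classes j {x \<in> A. L x = l} r \<longleftrightarrow> at_least_classes j {x \<in> B. L' x = l} r'"
  shows "\<exists>R R' h. transversal r A R \<and> transversal r' B R' \<and> bij_betw h R R' \<and>
    (\<forall>x\<in>R. L' (h x) = L x)"
proof -
  obtain R R' where R: "transversal r A R" and R': "transversal r' B R'"
    using transversal_exists[OF r(1), of A] transversal_exists[OF r'(1), of B] by blast
  have "\<exists>h. bij_betw h {x \<in> R. L x = l} {x \<in> R'. L' x = l}" for l
  proof (rule bij_betw_of_finite_subsets)
    fix j
    show "(\<exists>F. F \<subseteq> {x \<in> R. L x = l} \<and> finite F \<and> card F = j)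
        \<longleftrightarrow> (\<exists>F. F \<subseteq> {x \<in> R'. L' x = l} \<and> finite F \<and> card F = j)"
      using at_least_classes_transversal[OF r(1) transversal_restrict[of r A R L l, OF R r(2)], where j = j]
        at_least_classes_transversal[OF r'(1) transversal_restrict[of r' B R' L' l, OF R' r'(2)], where j = j] count
      by simp
  qed
  then obtain h where h: "\<And>l. bij_betw (h l) {x \<in> R. L x = l} {x \<in> R'. L' x = l}" by metis
  have hx: "h (L x) x \<in> R' \<and> L' (h (L x) x) = L x" if "x \<in> R" for x
    using bij_betwE[OF h[of "L x"]] that by blast
  \<comment> \<open>Each representative uses the bijection of its own label; images for distinct
    labels are disjoint because \<open>L'\<close> recovers the label.\<close>
  have "bij_betw (\<lambda>x. h (L x) x) R R'"
  proof (rule bij_betw_imageI)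
    show "inj_on (\<lambda>x. h (L x) x) R"
    proof (rule inj_onI)
      fix x y assume *: "x \<in> R" "y \<in> R" "h (L x) x = h (L y) y"
      then have "L x = L y" using hx by metis
      then show "x = y" using * bij_betw_imp_inj_on[OF h[of "L x"]] by (auto simp: inj_on_def)
    qed
    show "(\<lambda>x. h (L x) x) ` R = R'"
    proof
      show "R' \<subseteq> (\<lambda>x. h (L x) x) ` R"
      proof
        fix y assume "y \<in> R'"
        then have "y \<in> h (L' y) ` {x \<in> R. L x = L' y}" using bij_betw_imp_surj_on[OF h[of "L' y"]] by auto
        then obtain x where "x \<in> R" "y = h (L x) x" by auto
        then show "y \<in> (\<lambda>x. h (L x) x) ` R" by blast
      qed
    qed (use hx in auto)
  qed
  then show ?thesis using R R' hx by blast
qed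

lemma image_eqI_surj:
  assumes "surj d" "\<And>x. d x \<in> B \<longleftrightarrow> x \<in> A"
  shows "B = d ` A"
proof -
  have "y \<in> d ` A" if "y \<in> B" for y
    using that assms(2)[of "inv d y"] surj_f_inv_f[OF assms(1), of y] by (metis imageI)
  then show ?thesis using assms(2) by blast
qed

text \<open>The equation \<open>u = v\<close> is transported along \<open>f ^^ (a + c)\<close> to the orbits of \<open>x\<close> and \<open>y\<close>,
  which avoids negative powers of \<open>f\<close>.\<close>
lemma eq_iff_orbit_position:
  assumes f: "inj f" and u: "(f ^^ a) u = (f ^^ b) x" and v: "(f ^^ c) v = (f ^^ e) y"
    and xy: "orb f x y \<Longrightarrow> x = y"
  shows "u = v \<longleftrightarrow> x = y \<and> (c + b) mod per f x = (a + e) mod per f x"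
proof -
  have "u = v \<longleftrightarrow> (f ^^ (c + a)) u = (f ^^ (a + c)) v"
    using inj_funpow_iff[OF f, of "a + c" u v] by (simp add: add.commute)
  also have "\<dots> \<longleftrightarrow> (f ^^ (c + b)) x = (f ^^ (a + e)) y"
    by (simp only: funpow_add comp_apply u v)
  also have "\<dots> \<longleftrightarrow> x = y \<and> (f ^^ (c + b)) x = (f ^^ (a + e)) x"
    using xy unfolding orb_def by metis
  finally show ?thesis using funpow_eq_funpow_iff[OF f] by simp
qed

lemma conj_eq_iff_semiconj:
  assumes "bij d"
  shows "g = d \<circ> f \<circ> inv d \<longleftrightarrow> (\<forall>x. d (f x) = g (d x))"
proof
  assume "g = d \<circ> f \<circ> inv d"
  then show "\<forall>x. d (f x) = g (d x)" using assms by (simp add: bij_is_inj)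
next
  assume "\<forall>x. d (f x) = g (d x)"
  then show "g = d \<circ> f \<circ> inv d" using assms by (auto simp: fun_eq_iff bij_is_surj surj_f_inv_f)
qed

text \<open>One point of the symmetric difference is collected for each pair of distinct members. A
  list keeps the window in a countable type, as the indices of \<open>count_inv\<close>
  require.\<close>

lemma finite_separating_list:
  assumes "finite \<L>"
  shows "\<exists>G. \<forall>A\<in>\<L>. \<forall>B\<in>\<L>. A \<inter> set G = B \<inter> set G \<longrightarrow> A = B"
proof -
  have "\<exists>c. A \<noteq> B \<longrightarrow> (c \<in> A \<longleftrightarrow> c \<notin> B)" for A B :: "'a set" by blast
  then obtain c where c: "\<And>A B :: 'a set. A \<noteq> B \<Longrightarrow> c A B \<in> A \<longleftrightarrow> c A B \<notin> B" by metis
  obtain G where G: "set G = (\<lambda>(A, B). c A B) ` (\<L> \<times> \<L>)"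
    using finite_list[of "(\<lambda>(A, B). c A B) ` (\<L> \<times> \<L>)"] assms by blast
  have "A = B" if "A \<in> \<L>" "B \<in> \<L>" "A \<inter> set G = B \<inter> set G" for A B
  proof (rule ccontr)
    assume "A \<noteq> B"
    moreover have "c A B \<in> set G" using G that by auto
    ultimately show False using c[of A B] that(3) by blast
  qed
  then show ?thesis by blast
qed

section \<open>Permutations of blocks\<close>

text \<open>The blocks \<open>{i} \<times> N\<close> stand for the copies of the complete graph;
  \<open>automorphisms_disjoint_copies\<close> identifies these maps with the automorphisms.\<close>

definition block_perms :: "nat set \<Rightarrow> nat set \<Rightarrow> (nat \<times> nat \<Rightarrow> nat \<times> nat) set" where
  "block_perms M N = {f. f permutes M \<times> N \<and>
     (\<forall>u\<in>M \<times> N. \<forall>v\<in>M \<times> N. fst (f u) = fst (f v) \<longleftrightarrow> fst u = fst v)}"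

text \<open>The induced permutation of the copies, read off at the vertex \<open>(i, 0)\<close> of
  each; the locale \<open>blocks\<close> assumes that 0 is a vertex.\<close>

definition base :: "(nat \<times> nat \<Rightarrow> nat \<times> nat) \<Rightarrow> nat \<Rightarrow> nat" where
  "base f i = fst (f (i, 0))"

locale blocks =
  fixes M N :: "nat set"
  assumes zero: "0 \<in> N"
begin

abbreviation "V \<equiv> M \<times> N"
abbreviation "P \<equiv> block_perms M N"

lemma permutes: "f \<in> P \<Longrightarrow> f permutes V"
  by (simp add: block_perms_def)

lemma inj: "f \<in> P \<Longrightarrow> inj f"
  by (rule permutes_inj[OF permutes])

lemma mem_iff: "f \<in> P \<Longrightarrow> f x \<in> V \<longleftrightarrow> x \<in> V"
  by (rule permutes_in_image[OF permutes])

lemma fixes_outside: "f \<in> P \<Longrightarrow> x \<notin> V \<Longrightarrow> f x = x"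
  by (rule permutes_not_in[OF permutes])

lemma fst_eq_iff: "f \<in> P \<Longrightarrow> u \<in> V \<Longrightarrow> v \<in> V \<Longrightarrow> fst (f u) = fst (f v) \<longleftrightarrow> fst u = fst v"
  unfolding block_perms_def by blast

text \<open>A block is mapped into a single block, so the test vertex \<open>(i, 0)\<close> may be
  replaced by any vertex of its block.\<close>

lemma fst_apply: "f \<in> P \<Longrightarrow> x \<in> V \<Longrightarrow> fst (f x) = base f (fst x)"
  unfolding base_def using fst_eq_iff[of f x "(fst x, 0)"] zero by auto

lemma base_permutes:
  assumes f: "f \<in> P"
  shows "base f permutes M"
proof (rule bij_imp_permutes)
  show "base f i = i" if "i \<notin> M" for i
    using fixes_outside[OF f, of "(i, 0)"] that by (simp add: base_def)
  show "bij_betw (base f) M M"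
  proof (rule bij_betw_imageI)
    show "inj_on (base f) M"
      using fst_eq_iff[OF f] zero by (intro inj_onI) (force simp: base_def)
    show "base f ` M = M"
    proof
      show "base f ` M \<subseteq> M"
        using mem_iff[OF f] zero by (force simp: base_def mem_Times_iff)
      show "M \<subseteq> base f ` M"
      proof
        fix j assume "j \<in> M"
        then have "(j, 0) \<in> f ` V" using permutes_image[OF permutes[OF f]] zero by simp
        then obtain v where "v \<in> V" "f v = (j, 0)" by auto
        then show "j \<in> base f ` M" using fst_apply[OF f, of v] by (auto simp: image_iff)
      qed
    qed
  qed
qed

lemma base_inj: "f \<in> P \<Longrightarrow> inj (base f)"
  by (rule permutes_inj[OF base_permutes])

lemma funpow_mem_iff: "f \<in> P \<Longrightarrow> (f ^^ t) x \<in> V \<longleftrightarrow> x \<in> V"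
  by (induction t) (simp_all add: mem_iff[of f])

lemma fst_funpow:
  assumes "f \<in> P" "x \<in> V"
  shows "fst ((f ^^ t) x) = (base f ^^ t) (fst x)"
proof (induction t)
  case (Suc t)
  have "(f ^^ t) x \<in> V" using assms funpow_mem_iff by blast
  then show ?case using Suc fst_apply[OF assms(1)] by simp
qed simp

lemma comp_mem:
  assumes f: "f \<in> P" and g: "g \<in> P"
  shows "g \<circ> f \<in> P"
proof -
  have "fst (g (f u)) = fst (g (f v)) \<longleftrightarrow> fst u = fst v" if "u \<in> V" "v \<in> V" for u v
    using fst_eq_iff[OF g, of "f u" "f v"] fst_eq_iff[OF f that] mem_iff[OF f] that by simp
  then show ?thesis
    using permutes_compose[OF permutes[OF f] permutes[OF g]] by (simp add: block_perms_def)
qed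

lemma inv_mem:
  assumes f: "f \<in> P"
  shows "inv f \<in> P"
proof -
  have "fst (inv f u) = fst (inv f v) \<longleftrightarrow> fst u = fst v" if "u \<in> V" "v \<in> V" for u v
  proof -
    have "inv f u \<in> V" "inv f v \<in> V"
      using that permutes_in_image[OF permutes_inv[OF permutes[OF f]]] by auto
    then show ?thesis
      using fst_eq_iff[OF f, of "inv f u" "inv f v"] permutes_inverses(1)[OF permutes[OF f]] by simp
  qed
  then show ?thesis using permutes_inv[OF permutes[OF f]] by (simp add: block_perms_def)
qed

lemma base_comp:
  assumes "f \<in> P" "g \<in> P"
  shows "base (g \<circ> f) i = base g (base f i)"
proof (cases "i \<in> M")
  case True
  then have "f (i, 0) \<in> V" using mem_iff[OF assms(1)] zero by simp
  then show ?thesis using fst_apply[OF assms(2), of "f (i, 0)"] by (simp add: base_def)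
next
  case False
  then show ?thesis using fixes_outside[OF assms(1), of "(i, 0)"] by (simp add: base_def)
qed

text \<open>By conjugation invariance under \<open>f\<close> itself, the label depends only on the cycle of
  \<open>base f\<close> through \<open>i\<close>; together with the length of that cycle it determines \<open>f\<close> on the blocks of
  the cycle up to isomorphism.\<close>

definition label :: "(nat \<times> nat \<Rightarrow> nat \<times> nat) \<Rightarrow> nat \<Rightarrow> (nat \<times> nat) set" where
  "label f i = {(s, j). at_least_classes (Suc j) {x \<in> V. fst x = i \<and> per f x = s} (orb f)}"

text \<open>Labels are seen only through the finite windows \<open>set G\<close>, so that there are countably many
  invariants.\<close>

definition count_inv ::
    "(nat \<times> nat \<Rightarrow> nat \<times> nat) \<Rightarrow> nat \<times> (nat \<times> nat) list \<times> (nat \<times> nat) list \<times> nat \<Rightarrow> bool" where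
  "count_inv f = (\<lambda>(k, G, F, j).
     at_least_classes j {i \<in> M. per (base f) i = k \<and> label f i \<inter> set G = set F} (orb (base f)))"

section \<open>Conjugacy invariance of the counts\<close>

context
  fixes d f g
  assumes d: "d \<in> P" and f: "f \<in> P" and g: "g \<in> P" and semiconj: "\<And>x. d (f x) = g (d x)"
begin

lemma base_semiconj: "base d (base f i) = base g (base d i)"
proof -
  have "base d (base f i) = base (d \<circ> f) i" by (rule base_comp[OF f d, symmetric])
  also have "d \<circ> f = g \<circ> d" by (rule ext) (simp add: semiconj)
  also have "base (g \<circ> d) i = base g (base d i)" by (rule base_comp[OF d g])
  finally show ?thesis .
qed

text \<open>\<open>d\<close> maps block \<open>i\<close> onto block \<open>base d i\<close> and
  carries \<open>f\<close>-cycles to \<open>g\<close>-cycles of the same length.\<close>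

lemma label_semiconj:
  assumes "i \<in> M"
  shows "label g (base d i) = label f i"
proof -
  have "{x \<in> V. fst x = base d i \<and> per g x = s} = d ` {x \<in> V. fst x = i \<and> per f x = s}" for s
  proof (rule image_eqI_surj)
    show "surj d" using permutes_surj[OF permutes[OF d]] .
    fix x
    have "fst (d x) = base d i \<longleftrightarrow> fst x = i" if "x \<in> V"
      using fst_apply[OF d that] inj_eq[OF base_inj[OF d], of "fst x" i] by simp
    then show "d x \<in> {x \<in> V. fst x = base d i \<and> per g x = s} \<longleftrightarrow> x \<in> {x \<in> V. fst x = i \<and> per f x = s}"
      using mem_iff[OF d, of x] per_semiconj[of d f g, OF inj[OF d] semiconj, of x]
      by (simp only: mem_Collect_eq) blast
  qed
  then show ?thesis
    unfolding label_def by (simp add: at_least_classes_image[of _ "orb g" d "orb f", OF orb_semiconj[of d f g, OF inj[OF d] semiconj]])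
qed

text \<open>\<open>base d\<close> carries cycles of \<open>base f\<close> to cycles of
  \<open>base g\<close> with the same length and label. This is the invariance half of the
  classification.\<close>

lemma count_inv_semiconj: "count_inv g = count_inv f"
proof -
  have "{i \<in> M. per (base g) i = k \<and> label g i \<inter> G = F}
      = base d ` {i \<in> M. per (base f) i = k \<and> label f i \<inter> G = F}" for k G F
  proof (rule image_eqI_surj)
    show "surj (base d)" using permutes_surj[OF base_permutes[OF d]] .
    fix i
    show "base d i \<in> {i \<in> M. per (base g) i = k \<and> label g i \<inter> G = F}
        \<longleftrightarrow> i \<in> {i \<in> M. per (base f) i = k \<and> label f i \<inter> G = F}"
      using per_semiconj[of "base d" "base f" "base g", OF base_inj[OF d] base_semiconj, of i] label_semiconj[of i]
        permutes_in_image[OF base_permutes[OF d], of i] by auto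
  qed
  then show ?thesis
    unfolding count_inv_def by (simp add: at_least_classes_image[of _ "orb (base g)" "base d" "orb (base f)", OF orb_semiconj[of "base d" "base f" "base g", OF base_inj[OF d] base_semiconj]])
qed

end

lemma label_orb:
  assumes "f \<in> P" "orb (base f) i j"
  shows "label f i = label f j"
proof (rule orb_invariant[of "label f" "base f", OF _ assms(2)])
  fix i
  show "label f (base f i) = label f i"
  proof (cases "i \<in> M")
    case True
    then show ?thesis by (rule label_semiconj[OF assms(1) assms(1) assms(1) refl])
  next
    case False
    then show ?thesis using permutes_not_in[OF base_permutes[OF assms(1)]] by simp
  qed
qed

text \<open>The map \<open>d\<close> should send the translate of \<open>x\<close> by any power of
  \<open>f\<close> to the translate of \<open>h x\<close> by the same power of \<open>g\<close>.
  Equal periods make this a well-defined bijection. The hypotheses on \<open>base\<close> and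
  \<open>fst\<close> make it respect blocks: all representatives over one base cycle lie in one
  block, and \<open>h\<close> preserves lying in a common block.\<close>

lemma conjugator_exists:
  assumes f: "f \<in> P" and g: "g \<in> P"
    and R: "transversal (orb f) V R" and R': "transversal (orb g) V R'"
    and h: "bij_betw h R R'"
    and per: "\<And>x. x \<in> R \<Longrightarrow> per g (h x) = per f x"
    and base_per: "\<And>x. x \<in> R \<Longrightarrow> per (base g) (fst (h x)) = per (base f) (fst x)"
    and fst_h: "\<And>x y. x \<in> R \<Longrightarrow> y \<in> R \<Longrightarrow> fst (h x) = fst (h y) \<longleftrightarrow> fst x = fst y"
    and fst_R: "\<And>x y. x \<in> R \<Longrightarrow> y \<in> R \<Longrightarrow> orb (base f) (fst x) (fst y) \<Longrightarrow> fst x = fst y"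
    and fst_R': "\<And>x y. x \<in> R' \<Longrightarrow> y \<in> R' \<Longrightarrow> orb (base g) (fst x) (fst y) \<Longrightarrow> fst x = fst y"
  shows "\<exists>d\<in>P. \<forall>x. d (f x) = g (d x)"
proof -
  have RV: "x \<in> V" "h x \<in> R'" "h x \<in> V" if "x \<in> R" for x
    using that R R' bij_betwE[OF h] unfolding transversal_def by auto
  \<comment> \<open>The graph of \<open>d\<close>: \<open>y\<close> lies at position
    \<open>b - a\<close> relative to \<open>x\<close>, and \<open>y'\<close> at the same position
    relative to \<open>h x\<close>.\<close>
  define D where "D y y' \<longleftrightarrow> y \<in> V \<and> y' \<in> V \<and>
      (\<exists>x\<in>R. \<exists>a b. (f ^^ a) y = (f ^^ b) x \<and> (g ^^ a) y' = (g ^^ b) (h x))" for y y'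
  \<comment> \<open>One equivalence yields both well-definedness and injectivity. The statement on
    \<open>fst\<close> follows from the same computation of positions for \<open>base f\<close> and
    \<open>base g\<close>.\<close>
  have D_eq_iff: "y = z \<longleftrightarrow> y' = z'" and D_fst_iff: "fst y = fst z \<longleftrightarrow> fst y' = fst z'"
    if Dy: "D y y'" and Dz: "D z z'" for y y' z z'
  proof -
    obtain x a b where x: "x \<in> R" "(f ^^ a) y = (f ^^ b) x" "(g ^^ a) y' = (g ^^ b) (h x)"
      using Dy unfolding D_def by blast
    obtain w c e where w: "w \<in> R" "(f ^^ c) z = (f ^^ e) w" "(g ^^ c) z' = (g ^^ e) (h w)"
      using Dz unfolding D_def by blast
    have V: "y \<in> V" "y' \<in> V" "z \<in> V" "z' \<in> V" using Dy Dz by (auto simp only: D_def)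
    have "h x = h w \<longleftrightarrow> x = w"
      using x(1) w(1) bij_betw_imp_inj_on[OF h] by (auto dest: inj_onD)
    moreover have "orb f x w \<Longrightarrow> x = w" "orb g (h x) (h w) \<Longrightarrow> h x = h w"
      using R R' x(1) w(1) RV(2) unfolding transversal_def by blast+
    ultimately show "y = z \<longleftrightarrow> y' = z'"
      using eq_iff_orbit_position[OF inj[OF f] x(2) w(2)] eq_iff_orbit_position[OF inj[OF g] x(3) w(3)]
        per[OF x(1)] by simp
    have "(base f ^^ a) (fst y) = (base f ^^ b) (fst x)" "(base f ^^ c) (fst z) = (base f ^^ e) (fst w)"
      using arg_cong[OF x(2), of fst] arg_cong[OF w(2), of fst] fst_funpow[OF f] V RV(1)[OF x(1)] RV(1)[OF w(1)]
      by simp_all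
    note f_eqs = this
    have "(base g ^^ a) (fst y') = (base g ^^ b) (fst (h x))" "(base g ^^ c) (fst z') = (base g ^^ e) (fst (h w))"
      using arg_cong[OF x(3), of fst] arg_cong[OF w(3), of fst] fst_funpow[OF g] V RV(3)[OF x(1)] RV(3)[OF w(1)]
      by simp_all
    note g_eqs = this
    show "fst y = fst z \<longleftrightarrow> fst y' = fst z'"
      using eq_iff_orbit_position[OF base_inj[OF f] f_eqs fst_R[OF x(1) w(1)]]
        eq_iff_orbit_position[OF base_inj[OF g] g_eqs fst_R'[OF RV(2)[OF x(1)] RV(2)[OF w(1)]]]
        base_per[OF x(1)] fst_h[OF x(1) w(1)] by simp
  qed
  \<comment> \<open>Powers of \<open>k\<close> are onto, so translates by a negative amount exist;
    they stay in the vertex set.\<close>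
  have lift: "\<exists>y\<in>V. (k ^^ a) y = (k ^^ b) x" if k: "k \<in> P" and x: "x \<in> V" for k a b x
  proof -
    obtain y where "(k ^^ a) y = (k ^^ b) x"
      using surj_fn[OF permutes_surj[OF permutes[OF k]], of a] by (metis surjD)
    moreover from this have "y \<in> V" using funpow_mem_iff[OF k] x by metis
    ultimately show ?thesis by blast
  qed
  have total: "\<exists>y'. D y y'" if y: "y \<in> V" for y
  proof -
    obtain x a b where x: "x \<in> R" "(f ^^ a) y = (f ^^ b) x"
      using R y unfolding transversal_def orb_def by blast
    obtain y' where "y' \<in> V" "(g ^^ a) y' = (g ^^ b) (h x)" using lift[OF g RV(3)[OF x(1)]] by blast
    then show ?thesis unfolding D_def using x y by blast
  qed
  have onto: "\<exists>y. D y y'" if y': "y' \<in> V" for y'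
  proof -
    obtain x' a b where x': "x' \<in> R'" "(g ^^ a) y' = (g ^^ b) x'"
      using R' y' unfolding transversal_def orb_def by blast
    obtain x where x: "x \<in> R" "x' = h x" using x'(1) bij_betw_imp_surj_on[OF h] by blast
    obtain y where "y \<in> V" "(f ^^ a) y = (f ^^ b) x" using lift[OF f RV(1)[OF x(1)]] by blast
    then show ?thesis unfolding D_def using x x' y' by blast
  qed
  have step: "D (f y) (g y')" if Dy: "D y y'" for y y'
  proof -
    obtain x a b where x: "x \<in> R" "(f ^^ a) y = (f ^^ b) x" "(g ^^ a) y' = (g ^^ b) (h x)"
      using Dy unfolding D_def by blast
    have "(f ^^ a) (f y) = (f ^^ Suc b) x" "(g ^^ a) (g y') = (g ^^ Suc b) (h x)"
      using x by (simp_all add: funpow_swap1[symmetric])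
    moreover have "f y \<in> V" "g y' \<in> V" using Dy mem_iff[OF f] mem_iff[OF g] unfolding D_def by blast+
    ultimately show ?thesis unfolding D_def using x(1) by blast
  qed
  obtain d0 where d0: "\<And>y. y \<in> V \<Longrightarrow> D y (d0 y)" using total by metis
  define d where "d y = (if y \<in> V then d0 y else y)" for y
  have dD: "D y (d y)" if "y \<in> V" for y using d0 that by (simp add: d_def)
  have dV: "d y \<in> V" if "y \<in> V" for y using dD[OF that] unfolding D_def by blast
  have "d permutes V"
  proof (rule bij_imp_permutes)
    show "bij_betw d V V"
    proof (rule bij_betw_imageI)
      show "inj_on d V" using D_eq_iff dD by (intro inj_onI) metis
      show "d ` V = V"
      proof
        show "V \<subseteq> d ` V"
        proof
          fix y' assume "y' \<in> V"
          then obtain y where y: "D y y'" using onto by blast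
          then have "y \<in> V" unfolding D_def by blast
          moreover have "y' = d y" using D_eq_iff[OF y dD[OF \<open>y \<in> V\<close>]] by simp
          ultimately show "y' \<in> d ` V" by blast
        qed
      qed (use dV in blast)
    qed
  qed (simp add: d_def)
  moreover have "fst (d u) = fst (d v) \<longleftrightarrow> fst u = fst v" if "u \<in> V" "v \<in> V" for u v
    using D_fst_iff[OF dD[OF that(1)] dD[OF that(2)]] by simp
  ultimately have "d \<in> P" by (simp add: block_perms_def)
  moreover have "d (f x) = g (d x)" for x
  proof (cases "x \<in> V")
    case True
    then have fx: "f x \<in> V" using mem_iff[OF f] by blast
    \<comment> \<open>Both \<open>d (f x)\<close> and \<open>g (d x)\<close> are related to
      \<open>f x\<close> by \<open>D\<close>.\<close>
    show ?thesis using D_eq_iff[OF dD[OF fx] step[OF dD[OF True]]] by simp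
  next
    case False
    then show ?thesis using fixes_outside[OF f] fixes_outside[OF g] by (simp add: d_def)
  qed
  ultimately show ?thesis by blast
qed

section \<open>Finitely many types for each cycle length\<close>

lemma label_subset:
  assumes f: "f \<in> P" and N: "finite N" and i: "i \<in> M"
  shows "label f i \<subseteq> {..per (base f) i * card N} \<times> {..card N}"
proof
  fix c assume "c \<in> label f i"
  then obtain s j where c: "c = (s, j)"
      and "at_least_classes (Suc j) {x \<in> V. fst x = i \<and> per f x = s} (orb f)"
    unfolding label_def by blast
  then obtain xs where xs: "length xs = Suc j" "set xs \<subseteq> {x \<in> V. fst x = i \<and> per f x = s}"
      "sorted_wrt (\<lambda>x y. \<not> orb f x y) xs"
    unfolding at_least_classes_def by blast
  have "distinct xs"
    using xs(3) equivp_reflp[OF equivp_orb, of f]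
    by (metis distinct_conv_nth linorder_neqE_nat sorted_wrt_nth_less)
  moreover have "set xs \<subseteq> {i} \<times> N" using xs(2) by auto
  \<comment> \<open>The entry \<open>(s, j)\<close> stands for \<open>Suc j\<close> pairwise
    inequivalent, hence distinct, points of a block of size \<open>card N\<close>.\<close>
  ultimately have "Suc j \<le> card ({i} \<times> N)"
    using card_mono[of "{i} \<times> N" "set xs"] N xs(1) distinct_card[of xs] by simp
  moreover have "s \<le> per (base f) i * card N"
  proof -
    let ?k = "per (base f) i"
    have "hd xs \<in> set xs" using xs(1) by (cases xs) auto
    then obtain x where x: "x \<in> V" "fst x = i" "per f x = s" using xs(2) by blast
    \<comment> \<open>Multiples of the base period lead back to block \<open>i\<close>, so among
      \<open>card N + 1\<close> such times two give the same point, and \<open>s\<close> divides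
      their difference.\<close>
    have "(f ^^ (?k * t)) x \<in> {i} \<times> N" for t
    proof -
      have "(base f ^^ (?k * t)) i = i" using funpow_fixed_iff_per_dvd[OF base_inj[OF f]] by simp
      then have "fst ((f ^^ (?k * t)) x) = i" using fst_funpow[OF f x(1)] x(2) by simp
      moreover have "(f ^^ (?k * t)) x \<in> V" using funpow_mem_iff[OF f] x(1) by blast
      ultimately show ?thesis by (auto simp: mem_Times_iff)
    qed
    then have "(\<lambda>t. (f ^^ (?k * t)) x) ` {..card N} \<subseteq> {i} \<times> N" by blast
    then have "\<not> inj_on (\<lambda>t. (f ^^ (?k * t)) x) {..card N}"
      using card_inj_on_le[of "\<lambda>t. (f ^^ (?k * t)) x" "{..card N}" "{i} \<times> N"] N by auto
    then obtain t u where tu: "t < u" "u \<le> card N" "(f ^^ (?k * t)) x = (f ^^ (?k * u)) x"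
      unfolding inj_on_def by (metis atMost_iff linorder_neqE_nat)
    then have "?k * u mod s = ?k * t mod s"
      using funpow_eq_funpow_iff[OF inj[OF f], of "?k * t" x "?k * u"] x(3) by simp
    then have s: "s dvd ?k * (u - t)"
      using tu(1) mod_eq_dvd_iff_nat[of "?k * t" "?k * u" s] by (simp add: diff_mult_distrib2)
    show ?thesis
    proof (cases "?k = 0")
      case True
      \<comment> \<open>Here \<open>s dvd ?k * (u - t)\<close> says nothing. But
        \<open>base f\<close> has no positive return time at \<open>i\<close>, so neither has
        \<open>f\<close> at \<open>x\<close>, and \<open>s = 0\<close>.\<close>
      have "(f ^^ s) x = x" using funpow_fixed_iff_per_dvd[OF inj[OF f], of s x] x(3) by simp
      then have "(base f ^^ s) i = i" using fst_funpow[OF f x(1), of s] x(2) by simp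
      then show ?thesis using funpow_fixed_iff_per_dvd[OF base_inj[OF f], of s i] True by simp
    next
      case False
      then have "s \<le> ?k * (u - t)" using s tu(1) by (intro dvd_imp_le) auto
      also have "\<dots> \<le> ?k * card N" using tu(2) by (intro mult_le_mono) auto
      finally show ?thesis .
    qed
  qed
  ultimately show "c \<in> {..per (base f) i * card N} \<times> {..card N}"
    using c N by (simp add: card_cartesian_product)
qed

text \<open>For finite \<open>N\<close> the labels are subsets of a fixed finite box; for finite
  \<open>M\<close> there are only finitely many indices.\<close>

lemma finite_labels:
  assumes "f \<in> P" "finite M \<or> finite N"
  shows "finite (label f ` {i \<in> M. per (base f) i = k})"
proof (cases "finite N")
  case True
  have "label f ` {i \<in> M. per (base f) i = k} \<subseteq> Pow ({..k * card N} \<times> {..card N})"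
    using label_subset[OF assms(1) True] by blast
  then show ?thesis by (rule finite_subset) simp
qed (use assms(2) in simp)

lemma count_labels_eq:
  assumes f: "f \<in> P" and g: "g \<in> P" and fin: "finite M \<or> finite N"
    and count: "count_inv f = count_inv g"
  shows "at_least_classes j {i \<in> M. (per (base f) i, label f i) = l} (orb (base f))
     \<longleftrightarrow> at_least_classes j {i \<in> M. (per (base g) i, label g i) = l} (orb (base g))"
proof -
  obtain k L where l: "l = (k, L)" by (cases l)
  let ?A = "{i \<in> M. per (base f) i = k}" and ?B = "{i \<in> M. per (base g) i = k}"
  \<comment> \<open>\<open>L\<close> is added because it may occur for neither map; the window must
    still separate it from the labels that do occur.\<close>
  define \<L> where "\<L> = insert L (label f ` ?A \<union> label g ` ?B)"
  have "finite \<L>" unfolding \<L>_def using finite_labels[OF f fin] finite_labels[OF g fin] by simp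
  from finite_separating_list[OF this]
  obtain G where G: "\<forall>A\<in>\<L>. \<forall>B\<in>\<L>. A \<inter> set G = B \<inter> set G \<longrightarrow> A = B" ..
  obtain F where F: "set F = L \<inter> set G" using finite_list[of "L \<inter> set G"] by auto
  \<comment> \<open>On base cycles of length \<open>k\<close>, agreeing with \<open>L\<close> in the
    window now forces equality with \<open>L\<close>, so the count by type is one of the counts in
    \<open>count_inv\<close>.\<close>
  have sep: "{i \<in> M. (per (base q) i, label q i) = l} = {i \<in> M. per (base q) i = k \<and> label q i \<inter> set G = set F}"
    if "label q ` {i \<in> M. per (base q) i = k} \<subseteq> \<L>" for q
  proof -
    have "label q i \<inter> set G = L \<inter> set G \<longleftrightarrow> label q i = L" if "i \<in> M" "per (base q) i = k" for i
    proof -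
      have "label q i \<in> \<L>" "L \<in> \<L>" using that \<open>label q ` _ \<subseteq> \<L>\<close> by (auto simp: \<L>_def)
      then show ?thesis using G by blast
    qed
    then show ?thesis unfolding l F by auto
  qed
  have "label f ` ?A \<subseteq> \<L>" "label g ` ?B \<subseteq> \<L>" unfolding \<L>_def by blast+
  note sep[OF this(1)] sep[OF this(2)]
  then show ?thesis
    using fun_cong[OF count, of "(k, G, F, j)"] by (simp only: count_inv_def prod.case)
qed

section \<open>Equal counts give a conjugator\<close>

lemma transversal_Union:
  assumes f: "f \<in> P" and B: "transversal (orb (base f)) M B"
    and S: "\<And>i. i \<in> B \<Longrightarrow> transversal (orb f) {x \<in> V. fst x = i} (S i)"
  shows "transversal (orb f) V (\<Union>i\<in>B. S i)"
proof -
  have fst_S: "x \<in> V \<and> fst x = i" if "i \<in> B" "x \<in> S i" for i x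
    using transversal_subset[OF S[OF that(1)]] that(2) by auto
  \<comment> \<open>The base cycle of \<open>fst y\<close> meets \<open>B\<close>, so the
    \<open>f\<close>-cycle of \<open>y\<close> passes through the block of that index, at the point
    \<open>z\<close>.\<close>
  have "\<exists>x\<in>(\<Union>i\<in>B. S i). orb f y x" if y: "y \<in> V" for y
  proof -
    have "fst y \<in> M" using y by auto
    then obtain i a b where i: "i \<in> B" "(base f ^^ a) (fst y) = (base f ^^ b) i"
      using transversal_ex[OF B, of "fst y"] unfolding orb_def by blast
    obtain z where z: "(f ^^ b) z = (f ^^ a) y"
      using surj_fn[OF permutes_surj[OF permutes[OF f]], of b] by (metis surjD)
    have zV: "z \<in> V" using z funpow_mem_iff[OF f] y by metis
    have "(base f ^^ b) (fst z) = (base f ^^ b) i"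
      using fst_funpow[OF f zV, of b] fst_funpow[OF f y, of a] z i(2) by simp
    then have "fst z = i" using inj_funpow_iff[OF base_inj[OF f]] by simp
    then obtain x where x: "x \<in> S i" "orb f z x"
      using transversal_ex[OF S[OF i(1)], of z] zV by blast
    have "orb f y z" using z unfolding orb_def by metis
    then have "orb f y x" using x(2) by (rule equivp_transp[OF equivp_orb])
    then show ?thesis using x(1) i(1) by blast
  qed
  moreover have "x = y" if "i \<in> B" "x \<in> S i" "j \<in> B" "y \<in> S j" "orb f x y" for i j x y
  proof -
    have x: "x \<in> V" "fst x = i" and y: "y \<in> V" "fst y = j" using fst_S that by blast+
    from \<open>orb f x y\<close> obtain a b where "(f ^^ a) x = (f ^^ b) y"  unfolding orb_def by blast
    then have "(base f ^^ a) i = (base f ^^ b) j"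
      using fst_funpow[OF f x(1), of a] fst_funpow[OF f y(1), of b] x(2) y(2) by simp
    then have "orb (base f) i j" unfolding orb_def by blast
    then have "i = j" using transversal_unique[OF B] that(1,3) by blast
    then show ?thesis using transversal_unique[OF S[OF that(1)]] that(2,4,5) by blast
  qed
  ultimately show ?thesis using fst_S unfolding transversal_def UN_iff by blast
qed

text \<open>Two matchings: first base cycles of equal type, through representatives \<open>B\<close>
  and \<open>B'\<close>; then, for each pair \<open>i\<close> and \<open>t i\<close>, the cycles of
  equal length meeting these two blocks. The representatives of the second kind together represent
  all cycles, and \<open>conjugator_exists\<close> applies.\<close>

lemma conjugator_of_count_inv:
  assumes f: "f \<in> P" and g: "g \<in> P" and fin: "finite M \<or> finite N"
    and count: "count_inv f = count_inv g"
  shows "\<exists>d\<in>P. \<forall>x. d (f x) = g (d x)"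
proof -
  have orb_inv: "orb (base q) i j \<Longrightarrow> (per (base q) i, label q i) = (per (base q) j, label q j)"
    if "q \<in> P" for q i j
    using per_orb[OF base_inj[OF that], of i j] label_orb[OF that, of i j] by simp
  have "\<exists>B B' t. transversal (orb (base f)) M B \<and> transversal (orb (base g)) M B' \<and> bij_betw t B B' \<and>
      (\<forall>i\<in>B. (per (base g) (t i), label g (t i)) = (per (base f) i, label f i))"
    by (rule transversals_match[where L = "\<lambda>i. (per (base f) i, label f i)" and
          L' = "\<lambda>i. (per (base g) i, label g i)"])
      (rule equivp_orb count_labels_eq[OF assms] | erule orb_inv[OF f] orb_inv[OF g])+
  then obtain B B' t where B: "transversal (orb (base f)) M B" and B': "transversal (orb (base g)) M B'"
    and t: "bij_betw t B B'"
    and t_label: "\<And>i. i \<in> B \<Longrightarrow> (per (base g) (t i), label g (t i)) = (per (base f) i, label f i)"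
    by (elim exE conjE bexE) (rule that, auto)
  define matched where "matched i S S' h \<longleftrightarrow> transversal (orb f) {x \<in> V. fst x = i} S \<and>
      transversal (orb g) {x \<in> V. fst x = t i} S' \<and> bij_betw h S S' \<and> (\<forall>x\<in>S. per g (h x) = per f x)"
    for i S S' h
  have "\<exists>S S' h. matched i S S' h" if i: "i \<in> B" for i
    unfolding matched_def
  proof (rule transversals_match[where L = "per f" and L' = "per g",
        OF equivp_orb per_orb[OF inj[OF f]] equivp_orb per_orb[OF inj[OF g]]])
    fix j s
    \<comment> \<open>Labels record only positive numbers of classes; for zero classes both sides
      hold through the empty list.\<close>
    have Suc_eq: "at_least_classes (Suc j) {x \<in> {x \<in> V. fst x = i}. per f x = s} (orb f)
        = at_least_classes (Suc j) {x \<in> {x \<in> V. fst x = t i}. per g x = s} (orb g)" for j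
    proof -
      have "(s, j) \<in> label f i \<longleftrightarrow> (s, j) \<in> label g (t i)" using t_label[OF i] by simp
      then show ?thesis unfolding label_def by (simp add: conj_assoc)
    qed
    show "at_least_classes j {x \<in> {x \<in> V. fst x = i}. per f x = s} (orb f)
        = at_least_classes j {x \<in> {x \<in> V. fst x = t i}. per g x = s} (orb g)"
    proof (cases j)
      case 0
      then show ?thesis by (simp add: at_least_classes_def)
    next
      case (Suc j')
      then show ?thesis using Suc_eq[of j'] by (simp only: Suc)
    qed
  qed
  then obtain S S' h where matched: "\<And>i. i \<in> B \<Longrightarrow> matched i (S i) (S' i) (h i)"
    by metis
  have S: "\<And>i. i \<in> B \<Longrightarrow> transversal (orb f) {x \<in> V. fst x = i} (S i)"
    and S': "\<And>i. i \<in> B \<Longrightarrow> transversal (orb g) {x \<in> V. fst x = t i} (S' i)"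
    and h: "\<And>i. i \<in> B \<Longrightarrow> bij_betw (h i) (S i) (S' i)"
    and h_per: "\<And>i x. i \<in> B \<Longrightarrow> x \<in> S i \<Longrightarrow> per g (h i x) = per f x"
    using matched unfolding matched_def by simp_all
  have fst_S: "x \<in> V \<and> fst x = i" if "i \<in> B" "x \<in> S i" for i x
    using transversal_subset[OF S[OF that(1)]] that(2) by auto
  have fst_S': "x \<in> V \<and> fst x = t i" if "i \<in> B" "x \<in> S' i" for i x
    using transversal_subset[OF S'[OF that(1)]] that(2) by auto
  have t_inj: "t i = t j \<longleftrightarrow> i = j" if "i \<in> B" "j \<in> B" for i j
    using that bij_betw_imp_inj_on[OF t] by (auto dest: inj_onD)
  define R R' H where "R = (\<Union>i\<in>B. S i)" and "R' = (\<Union>i\<in>B. S' i)" and "H x = h (fst x) x" for x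
  have RE: "fst x \<in> B \<and> x \<in> S (fst x) \<and> H x \<in> S' (fst x) \<and> fst (H x) = t (fst x)" if "x \<in> R" for x
  proof -
    obtain i where i: "i \<in> B" "x \<in> S i" using \<open>x \<in> R\<close> unfolding R_def by blast
    then have "fst x = i" using fst_S by blast
    moreover have "h i x \<in> S' i" using bij_betwE[OF h[OF i(1)]] i(2) by blast
    ultimately show ?thesis using i fst_S'[OF i(1), of "h i x"] by (simp add: H_def)
  qed
  have fst_orb: "fst x = fst y" if "transversal (orb q) M C" "fst x \<in> C" "fst y \<in> C" "orb q (fst x) (fst y)"
    for q C and x y :: "nat \<times> nat"
    by (rule transversal_unique[OF that])
  show ?thesis
  proof (rule conjugator_exists[OF f g])
    show "transversal (orb f) V R" unfolding R_def by (rule transversal_Union[OF f B S])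
    \<comment> \<open>The family \<open>S'\<close> is indexed by \<open>B\<close>, while
      \<open>transversal_Union\<close> for \<open>g\<close> asks for indices in \<open>B'\<close>;
      the inverse of \<open>t\<close> reindexes it.\<close>
    have "transversal (orb g) V (\<Union>i\<in>B'. S' (inv_into B t i))"
    proof (rule transversal_Union[OF g B'])
      fix i assume "i \<in> B'"
      then have "i \<in> t ` B" using bij_betw_imp_surj_on[OF t] by simp
      then show "transversal (orb g) {x \<in> V. fst x = i} (S' (inv_into B t i))"
        using S'[of "inv_into B t i"] inv_into_into[of i t B] f_inv_into_f[of i t B] by simp
    qed
    moreover have "(\<Union>i\<in>B'. S' (inv_into B t i)) = R'"
      unfolding R'_def bij_betw_imp_surj_on[OF t, symmetric]
      using inv_into_f_f[OF bij_betw_imp_inj_on[OF t]] by auto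
    ultimately show "transversal (orb g) V R'" by simp
    show "bij_betw H R R'"
    proof (rule bij_betw_imageI)
      show "inj_on H R"
      proof (rule inj_onI)
        fix x y assume xy: "x \<in> R" "y \<in> R" "H x = H y"
        then have "fst x = fst y" using RE[OF xy(1)] RE[OF xy(2)] t_inj by metis
        then show "x = y"
          using xy RE[OF xy(1)] RE[OF xy(2)] bij_betw_imp_inj_on[OF h[of "fst x"]]
          by (auto simp: H_def dest: inj_onD)
      qed
      show "H ` R = R'"
      proof
        show "H ` R \<subseteq> R'" using RE unfolding R'_def by blast
        show "R' \<subseteq> H ` R"
        proof
          fix y assume "y \<in> R'"
          then obtain i where i: "i \<in> B" "y \<in> S' i" unfolding R'_def by blast
          then obtain x where x: "x \<in> S i" "y = h i x" using bij_betw_imp_surj_on[OF h[OF i(1)]] by blast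
          then have "y = H x" using fst_S[OF i(1)] by (simp add: H_def)
          moreover have "x \<in> R" using i x unfolding R_def by blast
          ultimately show "y \<in> H ` R" by blast
        qed
      qed
    qed
    fix x assume x: "x \<in> R"
    show "per g (H x) = per f x" using RE[OF x] h_per unfolding H_def by blast
    show "per (base g) (fst (H x)) = per (base f) (fst x)" using RE[OF x] t_label by simp
    fix y assume y: "y \<in> R"
    show "fst (H x) = fst (H y) \<longleftrightarrow> fst x = fst y" using RE[OF x] RE[OF y] t_inj by simp
    show "fst x = fst y" if "orb (base f) (fst x) (fst y)"
      using fst_orb[OF B conjunct1[OF RE[OF x]] conjunct1[OF RE[OF y]] that] .
  next
    fix x y assume xy: "x \<in> R'" "y \<in> R'" "orb (base g) (fst x) (fst y)"
    have "fst z \<in> B'" if "z \<in> R'" for z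
    proof -
      obtain i where "i \<in> B" "z \<in> S' i" using \<open>z \<in> R'\<close> unfolding R'_def by blast
      then show ?thesis using fst_S' bij_betwE[OF t] by metis
    qed
    from fst_orb[OF B' this[OF xy(1)] this[OF xy(2)] xy(3)] show "fst x = fst y" .
  qed
qed

end

section \<open>Borel measurability\<close>

text \<open>Each further iterate evaluates \<open>F f\<close> at a point that itself depends
  measurably on \<open>f\<close>; splitting by its countably many values keeps this
  measurable.\<close>

lemma measurable_funpow:
  fixes F :: "'b \<Rightarrow> 'a::countable \<Rightarrow> 'a"
  assumes "\<And>x. (\<lambda>f. F f x) \<in> X \<rightarrow>\<^sub>M count_space UNIV"
  shows "(\<lambda>f. (F f ^^ t) x) \<in> X \<rightarrow>\<^sub>M count_space UNIV"
proof (induction t)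
  case (Suc t)
  then show ?case
    using measurable_compose_countable[OF assms Suc] by simp
qed simp

lemma pred_orb:
  fixes F :: "'b \<Rightarrow> 'a::countable \<Rightarrow> 'a"
  assumes "\<And>x. (\<lambda>f. F f x) \<in> X \<rightarrow>\<^sub>M count_space UNIV"
  shows "Measurable.pred X (\<lambda>f. orb (F f) x y)"
proof -
  note [measurable] = measurable_funpow[of F, OF assms]
  show ?thesis unfolding orb_def by measurable
qed

lemma pred_per_eq:
  fixes F :: "'b \<Rightarrow> 'a::countable \<Rightarrow> 'a"
  assumes "\<And>x. (\<lambda>f. F f x) \<in> X \<rightarrow>\<^sub>M count_space UNIV" and inj: "\<And>f. f \<in> space X \<Longrightarrow> inj (F f)"
  shows "Measurable.pred X (\<lambda>f. per (F f) x = s)"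
proof -
  note [measurable] = measurable_funpow[of F, OF assms(1)]
  have "Measurable.pred X (\<lambda>f. \<forall>t. (F f ^^ t) x = x \<longleftrightarrow> s dvd t)" by measurable
  then show ?thesis
    by (rule measurable_cong[THEN iffD2, rotated]) (rule per_eq_iff[OF inj])
qed

text \<open>There are only countably many lists over a countable type, so this is a countable union
  once \<open>sorted_wrt\<close> is written with indices.\<close>

lemma pred_at_least_classes:
  fixes A :: "'b \<Rightarrow> 'a::countable set"
  assumes [measurable]: "\<And>x. Measurable.pred X (\<lambda>f. x \<in> A f)" "\<And>x y. Measurable.pred X (\<lambda>f. r f x y)"
  shows "Measurable.pred X (\<lambda>f. at_least_classes j (A f) (r f))"
proof -
  have "Measurable.pred X (\<lambda>f. \<exists>xs. length xs = j \<and> (\<forall>x\<in>set xs. x \<in> A f) \<and>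
      (\<forall>p q. p < q \<longrightarrow> q < length xs \<longrightarrow> \<not> r f (xs ! p) (xs ! q)))"
    by measurable
  then show ?thesis unfolding at_least_classes_def sorted_wrt_iff_nth_less subset_eq by simp
qed

lemma (in blocks) pred_count_inv:
  assumes meas: "\<And>x. (\<lambda>f. f x) \<in> X \<rightarrow>\<^sub>M count_space UNIV" and space: "space X \<subseteq> P"
  shows "Measurable.pred X (\<lambda>f. count_inv f c)"
proof -
  have base_meas: "(\<lambda>f. base f i) \<in> X \<rightarrow>\<^sub>M count_space UNIV" for i
    unfolding base_def by (rule measurable_compose[OF meas]) simp
  note [measurable] = pred_orb[of "\<lambda>f. f", OF meas] pred_orb[of base, OF base_meas]
  have [measurable]: "Measurable.pred X (\<lambda>f. per f x = s)" for x s
    using pred_per_eq[of "\<lambda>f. f", OF meas inj] space by blast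
  have [measurable]: "Measurable.pred X (\<lambda>f. per (base f) i = s)" for i s
    using pred_per_eq[of base, OF base_meas base_inj] space by blast
  have [measurable]: "Measurable.pred X (\<lambda>f. e \<in> label f i)" for e i
    unfolding label_def case_prod_unfold mem_Collect_eq
    by (intro pred_at_least_classes) (unfold mem_Collect_eq, measurable)
  have [measurable]: "Measurable.pred X (\<lambda>f. label f i \<inter> set G = set F)" for i G F
  proof -
    \<comment> \<open>Extensionality turns the equation of sets into a countable conjunction over
      \<open>e\<close>.\<close>
    have "Measurable.pred X (\<lambda>f. \<forall>e. (e \<in> label f i \<and> e \<in> set G) \<longleftrightarrow> e \<in> set F)" by measurable
    then show ?thesis unfolding set_eq_iff Int_iff .
  qed
  show ?thesis
    unfolding count_inv_def case_prod_unfold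
    by (intro pred_at_least_classes) (unfold mem_Collect_eq, measurable)
qed

section \<open>Smoothness\<close>

text \<open>Adjacency means being distinct and in the same copy. A permutation preserves
  distinctness anyway, so preserving edges means preserving copies.\<close>

lemma automorphisms_disjoint_copies:
  "automorphisms (disjoint_copies m (complete_graph n)) = block_perms {i. enat i < m} {j. enat j < n}"
proof -
  let ?V = "{i. enat i < m} \<times> {j. enat j < n}"
  let ?G = "disjoint_copies m (complete_graph n)"
  have V: "vertices ?G = ?V" by (simp add: disjoint_copies_def complete_graph_def)
  have E: "{u, v} \<in> edges ?G \<longleftrightarrow> fst u = fst v \<and> u \<noteq> v" if "u \<in> ?V" "v \<in> ?V" for u v
  proof
    assume "{u, v} \<in> edges ?G"
    then obtain i j k where "{u, v} = {(i, j), (i, k)}" "j \<noteq> k"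
      by (auto simp: disjoint_copies_def complete_graph_def)
    then show "fst u = fst v \<and> u \<noteq> v" by (auto simp: doubleton_eq_iff)
  next
    assume uv: "fst u = fst v \<and> u \<noteq> v"
    obtain i j k where "u = (i, j)" "v = (i, k)" using uv by (metis prod.collapse)
    moreover from this have "{j, k} \<in> edges (complete_graph n)"
      using that uv by (auto simp: complete_graph_def)
    moreover have "enat i < m" using that calculation by auto
    ultimately have "{u, v} = Pair i ` {j, k} \<and> enat i < m \<and> {j, k} \<in> edges (complete_graph n)" by simp
    then show "{u, v} \<in> edges ?G" unfolding disjoint_copies_def snd_conv by blast
  qed
  show ?thesis
  proof (intro set_eqI)
    fix f
    have "(\<forall>u\<in>?V. \<forall>v\<in>?V. {f u, f v} \<in> edges ?G \<longleftrightarrow> {u, v} \<in> edges ?G) \<longleftrightarrow>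
        (\<forall>u\<in>?V. \<forall>v\<in>?V. fst (f u) = fst (f v) \<longleftrightarrow> fst u = fst v)" if f: "f permutes ?V"
    proof (intro ball_cong refl)
      fix u v assume uv: "u \<in> ?V" "v \<in> ?V"
      then have "f u \<in> ?V" "f v \<in> ?V" using permutes_in_image[OF f] by blast+
      then show "({f u, f v} \<in> edges ?G \<longleftrightarrow> {u, v} \<in> edges ?G) \<longleftrightarrow> (fst (f u) = fst (f v) \<longleftrightarrow> fst u = fst v)"
        unfolding E[OF uv] E[OF \<open>f u \<in> ?V\<close> \<open>f v \<in> ?V\<close>] inj_eq[OF permutes_inj[OF f]] by auto
    qed
    then show "f \<in> automorphisms ?G \<longleftrightarrow> f \<in> block_perms {i. enat i < m} {j. enat j < n}"
      unfolding automorphisms_def block_perms_def V mem_Collect_eq by blast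
  qed
qed

section \<open>Conjugacy and its complete invariant\<close>

context blocks
begin

definition conj_rel where
  "conj_rel = {(f, g). f \<in> P \<and> g \<in> P \<and> (\<exists>d\<in>P. g = d \<circ> f \<circ> inv d)}"

lemma bij: "f \<in> P \<Longrightarrow> bij f"
  by (rule permutes_bij[OF permutes])

lemma conj_iff:
  assumes "f \<in> P" "g \<in> P"
  shows "(f, g) \<in> conj_rel \<longleftrightarrow> (\<exists>d\<in>P. \<forall>x. d (f x) = g (d x))"
  unfolding conj_rel_def using assms conj_eq_iff_semiconj[OF bij] by auto

lemma equiv_conj_rel: "equiv P conj_rel"
proof (rule equivI)
  show "conj_rel \<subseteq> P \<times> P" unfolding conj_rel_def by blast
  show "refl_on P conj_rel"
  proof (rule refl_onI)
    fix f assume f: "f \<in> P"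
    then show "(f, f) \<in> conj_rel" unfolding conj_iff[OF f f] by (intro bexI[of _ f]) auto
  qed
  show "sym conj_rel"
  proof (rule symI)
    fix f g assume fg: "(f, g) \<in> conj_rel"
    then have P: "f \<in> P" "g \<in> P" unfolding conj_rel_def by auto
    then obtain d where d: "d \<in> P" "\<And>x. d (f x) = g (d x)" using fg conj_iff by blast
    have "inv d (g x) = f (inv d x)" for x
      using d(2)[of "inv d x"] permutes_inverses[OF permutes[OF d(1)]] by metis
    then show "(g, f) \<in> conj_rel" unfolding conj_iff[OF P(2,1)] using inv_mem[OF d(1)] by blast
  qed
  show "trans conj_rel"
  proof (rule transI)
    fix f g k assume fg: "(f, g) \<in> conj_rel" and gk: "(g, k) \<in> conj_rel"
    then have P: "f \<in> P" "g \<in> P" "k \<in> P" unfolding conj_rel_def by auto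
    obtain d where d: "d \<in> P" "\<And>x. d (f x) = g (d x)" using fg conj_iff[OF P(1,2)] by blast
    obtain e where e: "e \<in> P" "\<And>x. e (g x) = k (e x)" using gk conj_iff[OF P(2,3)] by blast
    have "(e \<circ> d) (f x) = k ((e \<circ> d) x)" for x by (simp add: d(2) e(2))
    then show "(f, k) \<in> conj_rel" unfolding conj_iff[OF P(1,3)] using comp_mem[OF d(1) e(1)] by blast
  qed
qed

lemma conj_iff_count_inv:
  assumes "finite M \<or> finite N" "f \<in> P" "g \<in> P"
  shows "(f, g) \<in> conj_rel \<longleftrightarrow> count_inv f = count_inv g"
  unfolding conj_iff[OF assms(2,3)]
  using conjugator_of_count_inv[OF assms(2,3,1)] count_inv_semiconj[OF _ assms(2,3)] by metis

end

theorem theorem3p1: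
  fixes m n :: enat
  assumes "m \<ge> 1" and "n \<ge> 1" and "m \<noteq> \<infinity> \<or> n \<noteq> \<infinity>"
  shows "smooth_equiv (borel_of (aut_topology (disjoint_copies m (complete_graph n))))
           (conjugacy_rel (disjoint_copies m (complete_graph n)))"
proof -
  define M N where "M = {i. enat i < m}" and "N = {j. enat j < n}"
  let ?G = "disjoint_copies m (complete_graph n)"
  let ?X = "borel_of (aut_topology ?G)"
  interpret blocks M N
    by standard (use assms(2) in \<open>auto simp: N_def simp flip: zero_enat_def\<close>)
  have aut: "automorphisms ?G = P" unfolding M_def N_def by (rule automorphisms_disjoint_copies)
  have rel: "conjugacy_rel ?G = conj_rel" by (simp add: conjugacy_rel_def conj_rel_def aut)
  have space: "space ?X = P" by (simp add: space_borel_of_aut_topology aut)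
  have fin: "finite M \<or> finite N"
  proof -
    have "finite {i. enat i < q}" if "q \<noteq> \<infinity>" for q
      using that by (cases q) auto
    then show ?thesis using assms(3) unfolding M_def N_def by blast
  qed
  \<comment> \<open>The countably many invariants are enumerated by \<open>from_nat\<close> and
    recorded as a 0-1 sequence, a point of the Baire space
    \<open>nat \<Rightarrow> nat\<close>.\<close>
  define F :: "_ \<Rightarrow> nat \<Rightarrow> nat" where "F f c = of_bool (count_inv f (from_nat c))" for f c
  have "(\<lambda>f. F f c) \<in> borel_measurable ?X" for c
  proof -
    have [measurable]: "Measurable.pred ?X (\<lambda>f. count_inv f (from_nat c))"
      by (rule pred_count_inv[OF measurable_aut_eval]) (simp add: space)
    show ?thesis unfolding F_def of_bool_def by measurable
  qed
  then have "F \<in> ?X \<rightarrow>\<^sub>M borel" by (rule measurable_coordinatewise_then_product)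
  moreover have "(f, g) \<in> conj_rel \<longleftrightarrow> F f = F g" if "f \<in> space ?X" "g \<in> space ?X" for f g
  proof -
    have "F f = F g \<longleftrightarrow> (\<forall>c. count_inv f (from_nat c) = count_inv g (from_nat c))"
      unfolding F_def fun_eq_iff of_bool_eq_iff ..
    also have "\<dots> \<longleftrightarrow> count_inv f = count_inv g"
    proof
      assume *: "\<forall>c. count_inv f (from_nat c) = count_inv g (from_nat c)"
      show "count_inv f = count_inv g"
      proof
        fix c show "count_inv f c = count_inv g c" using *[rule_format, of "to_nat c"] by simp
      qed
    qed simp
    finally show ?thesis using conj_iff_count_inv[OF fin] that space by simp
  qed
  ultimately show ?thesis
    unfolding smooth_equiv_def rel space
    using standard_borel_aut_topology equiv_conj_rel standard_borel_borel_nat_fun space by auto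
qed

end
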